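(* Let $\phi>0$ be a constant, let $\epsilon>0$ and let $M$ be a positive integer. When allocated $\left\lceil \frac{1+\phi}{\epsilon}\right\rceil$ counters, the algorithm FAST$(M,\epsilon,\phi)$ operates in constant time (each Add and each Query operation takes $O(1)$ time) and solves the $(\epsilon,M)$-Volume Estimation problem: after processing any $(\mathcal U,M)$-weighted stream of length $N$, for every $x\in\mathcal U$, the value $\widehat{v_x}$ returned by Query$(x)$ satisfies $$v_x\le \widehat{v_x}\le v_x+N\cdot M\cdot\epsilon .$$
   Context: Streams. Given a set $\mathcal U$ (the universe of ids) and a positive integer $M$, a $(\mathcal U,M)$-weighted stream of length $N$ is a sequence $\langle p_1,\dots,p_N\rangle$ with $p_i=(d_i,w_i)\in\mathcal U\times\{1,\dots,M\}$; $d_i$ is the id and $w_i$ the weight. The volume of $x\in\mathcal U$ is $v_x=\sum_{i:\,d_i=x}w_i$. Processing the stream means calling Add$(d_i,w_i)$ for $i=1,\dots,N$ in order. Algorithm FAST$(M,\epsilon,\phi)$. Let $s=\lfloor M\phi/2+1\rfloor$ and $\mathfrak C=\lceil (1+\phi)/\epsilon\rceil$. The state is a set $C\subseteq\mathcal U$ of items with allocated counters and non-negative integers $c_x,r_x$ for $x\in\mathcal U$. Initially $C=\emptyset$ and $c_x=r_x=0$ for all $x$. Add$(x,w)$: if $x\in C$ or $|C|<\mathfrak C$, then set $c_x\gets c_x+\lfloor (r_x+w)/s\rfloor$ and $r_x\gets (r_x+w)\bmod s$ (both right-hand sides using the old $r_x$), and $C\gets C\cup\{x\}$. Otherwise, choose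 an arbitrary $m\in\arg\min_{y\in C}c_y$, set $c_x\gets c_m+\lfloor (s-1+w)/s\rfloor$, $r_x\gets (s-1+w)\bmod s$, and $C\gets (C\setminus\{m\})\cup\{x\}$. Query$(x)$: if $x\in C$ or $|C|<\mathfrak C$, return $r_x+s\cdot c_x$; otherwise return $s-1+s\cdot\min_{y\in C}c_y$. Data structure (SOS) and cost model. The items of $C$ are kept in groups according to the value $c_x$; the nonempty groups form a linked list ordered by increasing $c$-value; inside a group the items are unordered, and each item's node stores its remainder $r_x$. A separate hash table maps each id in $C$ to its node. Hash table accesses, arithmetic operations, moving from one group to an adjacent one, and inserting/removing an item from a group each cost $O(1)$. *)

theory Defs
  imports Complex_Main "HOL-Library.Monad_Syntax"
begin

section \<open>Weighted streams and volume estimation\<close>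

definition weighted_stream :: "'a set \<Rightarrow> nat \<Rightarrow> ('a \<times> nat) list \<Rightarrow> bool" where
  "weighted_stream U M p \<longleftrightarrow> set p \<subseteq> U \<times> {1..M}"

definition volume :: "('a \<times> nat) list \<Rightarrow> 'a \<Rightarrow> nat" where
  "volume p x = (\<Sum>i | i < length p \<and> fst (p ! i) = x. snd (p ! i))"

text \<open>
  An algorithm is given by the relation \<open>run\<close> between a stream and the states it may be in after
  processing that stream (there may be several, since choices can be arbitrary), and by its query
  function.
\<close>

definition solves_volume_estimation ::
  "'a set \<Rightarrow> nat \<Rightarrow> real \<Rightarrow> (('a \<times> nat) list \<Rightarrow> 'st \<Rightarrow> bool) \<Rightarrow> ('st \<Rightarrow> 'a \<Rightarrow> nat) \<Rightarrow> bool" where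
  "solves_volume_estimation U M \<epsilon> run query \<longleftrightarrow>
     (\<forall>p st. weighted_stream U M p \<and> run p st \<longrightarrow>
       (\<forall>x\<in>U. real (volume p x) \<le> real (query st x) \<and>
              real (query st x) \<le> real (volume p x) + real (length p) * real M * \<epsilon>))"


section \<open>The algorithm FAST\<close>

definition fast_unit :: "nat \<Rightarrow> real \<Rightarrow> nat" where
  "fast_unit M \<phi> = nat \<lfloor>real M * \<phi> / 2 + 1\<rfloor>"

definition fast_counters :: "real \<Rightarrow> real \<Rightarrow> nat" where
  "fast_counters \<epsilon> \<phi> = nat \<lceil>(1 + \<phi>) / \<epsilon>\<rceil>"

record 'a fast =
  tracked :: "'a set"
  cnt :: "'a \<Rightarrow> nat"
  rmd :: "'a \<Rightarrow> nat"

definition fast_init :: "'a fast" where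
  "fast_init = \<lparr>tracked = {}, cnt = (\<lambda>_. 0), rmd = (\<lambda>_. 0)\<rparr>"

text \<open>
  Below, \<open>s\<close> is the value of \<^const>\<open>fast_unit\<close> and \<open>n\<close> the number of allocated counters.
  \<open>fast_add\<close> is a relation because the evicted minimal item is arbitrary.
\<close>

definition fast_add :: "nat \<Rightarrow> nat \<Rightarrow> 'a \<Rightarrow> nat \<Rightarrow> 'a fast \<Rightarrow> 'a fast \<Rightarrow> bool" where
  "fast_add s n x w st st' \<longleftrightarrow>
     (if x \<in> tracked st \<or> card (tracked st) < n then
        st' = \<lparr>tracked = insert x (tracked st),
               cnt = (cnt st)(x := cnt st x + (rmd st x + w) div s),
               rmd = (rmd st)(x := (rmd st x + w) mod s)\<rparr>
      else
        (\<exists>m. is_arg_min (cnt st) (\<lambda>y. y \<in> tracked st) m \<and>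
          st' = \<lparr>tracked = insert x (tracked st - {m}),
                 cnt = (cnt st)(x := cnt st m + (s - 1 + w) div s),
                 rmd = (rmd st)(x := (s - 1 + w) mod s)\<rparr>))"

definition fast_query :: "nat \<Rightarrow> nat \<Rightarrow> 'a fast \<Rightarrow> 'a \<Rightarrow> nat" where
  "fast_query s n st x =
     (if x \<in> tracked st \<or> card (tracked st) < n then rmd st x + s * cnt st x
      else s - 1 + s * Min (cnt st ` tracked st))"

inductive fast_run :: "nat \<Rightarrow> nat \<Rightarrow> ('a \<times> nat) list \<Rightarrow> 'a fast \<Rightarrow> bool" for s n where
  fast_run_Nil: "fast_run s n [] fast_init"
| fast_run_snoc: "fast_run s n p st \<Longrightarrow> fast_add s n x w st st' \<Longrightarrow> fast_run s n (p @ [(x, w)]) st'"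


section \<open>Nondeterministic computations with running time\<close>

text \<open>
  A computation is the set of its possible outcomes, each paired with its cost.
\<close>

datatype 'r comp = Comp (outcomes: "('r \<times> nat) set")

definition ret :: "'r \<Rightarrow> 'r comp" where
  "ret v = Comp {(v, 0)}"

definition tick :: "'r \<Rightarrow> 'r comp" where
  "tick v = Comp {(v, 1)}"

definition pick :: "'r set \<Rightarrow> 'r comp" where
  "pick A = Comp {(v, 1) | v. v \<in> A}"

definition bind_comp :: "'q comp \<Rightarrow> ('q \<Rightarrow> 'r comp) \<Rightarrow> 'r comp" where
  "bind_comp m f = Comp {(v, t + t') | u t v t'. (u, t) \<in> outcomes m \<and> (v, t') \<in> outcomes (f u)}"

adhoc_overloading Monad_Syntax.bind \<rightleftharpoons> bind_comp


section \<open>The data structure SOS\<close>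

text \<open>
  A group is a \<open>c\<close>-value with the unordered items having that value; the linked list of groups is
  kept in increasing order. As distinct groups have distinct \<open>c\<close>-values, the \<open>c\<close>-value serves as the
  reference from an item's node to the group it lies in: a node is a pair of this reference and
  the remainder.
\<close>

type_synonym 'a group = "nat \<times> 'a set"

record 'a sos =
  groups :: "'a group list"
  htable :: "'a \<Rightarrow> (nat \<times> nat) option"
  used :: nat

definition sos_init :: "'a sos" where
  "sos_init = \<lparr>groups = [], htable = Map.empty, used = 0\<rparr>"

text \<open>
  A position in the linked list is a pair of the groups before it and the groups from it on.
  \<open>locate\<close> gives the position that a node's reference points to. In the programs below
  it is charged as following this pointer, not as a search.
\<close>

definition locate :: "nat \<Rightarrow> 'a group list \<Rightarrow> 'a group list \<times> 'a group list" where
  "locate k gs = (takeWhile (\<lambda>g. fst g \<noteq> k) gs, dropWhile (\<lambda>g. fst g \<noteq> k) gs)"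

fun detach :: "'a \<Rightarrow> 'a group list \<Rightarrow> 'a group list" where
  "detach x [] = []"
| "detach x ((k, X) # gs) = (if X - {x} = {} then gs else (k, X - {x}) # gs)"

fun attach :: "'a \<Rightarrow> nat \<Rightarrow> 'a group list \<Rightarrow> 'a group list" where
  "attach x k [] = [(k, {x})]"
| "attach x k ((j, X) # gs) = (if j = k then (j, insert x X) # gs else (k, {x}) # (j, X) # gs)"

text \<open>
  The only search in the data structure is this walk, which starts at the current position and
  moves to the next group as long as the \<open>c\<close>-value is below \<open>k\<close>, paying for each comparison and
  each move.
\<close>

fun walk :: "nat \<Rightarrow> 'a group list \<Rightarrow> 'a group list \<Rightarrow> ('a group list \<times> 'a group list) comp" where
  "walk k bef [] = ret (bef, [])"
| "walk k bef ((j, X) # aft) = do {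
     below \<leftarrow> tick (j < k);
     if below then do { tick (); walk k (bef @ [(j, X)]) aft }
     else ret (bef, (j, X) # aft)
   }"

definition place :: "'a \<Rightarrow> nat \<Rightarrow> 'a group list \<Rightarrow> 'a group list \<Rightarrow> 'a group list comp" where
  "place x k bef aft = do {
     (bef', aft') \<leftarrow> walk k bef aft;
     aft'' \<leftarrow> tick (attach x k aft');
     ret (bef' @ aft'')
   }"

definition sos_add :: "nat \<Rightarrow> nat \<Rightarrow> 'a \<Rightarrow> nat \<Rightarrow> 'a sos \<Rightarrow> 'a sos comp" where
  "sos_add s n x w \<sigma> = do {
     entry \<leftarrow> tick (htable \<sigma> x);
     case entry of
       Some (g, r) \<Rightarrow> do {
         (bef, aft) \<leftarrow> tick (locate g (groups \<sigma>));
         k \<leftarrow> tick (fst (hd aft));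
         aft' \<leftarrow> tick (detach x aft);
         a \<leftarrow> tick (r + w);
         q \<leftarrow> tick (a div s);
         r' \<leftarrow> tick (a mod s);
         k' \<leftarrow> tick (k + q);
         gs \<leftarrow> place x k' bef aft';
         T \<leftarrow> tick ((htable \<sigma>)(x := Some (k', r')));
         ret \<lparr>groups = gs, htable = T, used = used \<sigma>\<rparr>
       }
     | None \<Rightarrow> do {
         free \<leftarrow> tick (used \<sigma> < n);
         if free then do {
           k' \<leftarrow> tick (w div s);
           r' \<leftarrow> tick (w mod s);
           gs \<leftarrow> place x k' [] (groups \<sigma>);
           T \<leftarrow> tick ((htable \<sigma>)(x := Some (k', r')));
           u \<leftarrow> tick (used \<sigma> + 1);
           ret \<lparr>groups = gs, htable = T, used = u\<rparr>
         } else do {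
           (k, X) \<leftarrow> tick (hd (groups \<sigma>));
           m \<leftarrow> pick X;
           aft \<leftarrow> tick (detach m (groups \<sigma>));
           T \<leftarrow> tick ((htable \<sigma>)(m := None));
           b \<leftarrow> tick (s - 1);
           a \<leftarrow> tick (b + w);
           q \<leftarrow> tick (a div s);
           r' \<leftarrow> tick (a mod s);
           k' \<leftarrow> tick (k + q);
           gs \<leftarrow> place x k' [] aft;
           T' \<leftarrow> tick (T(x := Some (k', r')));
           ret \<lparr>groups = gs, htable = T', used = used \<sigma>\<rparr>
         }
       }
   }"

definition sos_query :: "nat \<Rightarrow> nat \<Rightarrow> 'a sos \<Rightarrow> 'a \<Rightarrow> nat comp" where
  "sos_query s n \<sigma> x = do {
     entry \<leftarrow> tick (htable \<sigma> x);
     case entry of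
       Some (g, r) \<Rightarrow> do {
         (bef, aft) \<leftarrow> tick (locate g (groups \<sigma>));
         k \<leftarrow> tick (fst (hd aft));
         a \<leftarrow> tick (s * k);
         tick (r + a)
       }
     | None \<Rightarrow> do {
         free \<leftarrow> tick (used \<sigma> < n);
         if free then ret 0
         else do {
           (k, X) \<leftarrow> tick (hd (groups \<sigma>));
           a \<leftarrow> tick (s * k);
           b \<leftarrow> tick (s - 1);
           tick (b + a)
         }
       }
   }"

inductive sos_run :: "nat \<Rightarrow> nat \<Rightarrow> ('a \<times> nat) list \<Rightarrow> 'a sos \<Rightarrow> bool" for s n where
  sos_run_Nil: "sos_run s n [] sos_init"
| sos_run_snoc: "sos_run s n p \<sigma> \<Longrightarrow> (\<sigma>', t) \<in> outcomes (sos_add s n x w \<sigma>)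
    \<Longrightarrow> sos_run s n (p @ [(x, w)]) \<sigma>'"

text \<open>
  The values of \<^const>\<open>cnt\<close> and \<^const>\<open>rmd\<close> outside \<^const>\<open>tracked\<close> are not stored: they are \<open>0\<close> as long
  as a counter is free, and irrelevant afterwards.
\<close>

definition represents :: "'a sos \<Rightarrow> 'a fast \<Rightarrow> bool" where
  "represents \<sigma> st \<longleftrightarrow>
     finite (tracked st) \<and> used \<sigma> = card (tracked st) \<and>
     htable \<sigma> = (\<lambda>x. if x \<in> tracked st then Some (cnt st x, rmd st x) else None) \<and>
     sorted_wrt (<) (map fst (groups \<sigma>)) \<and>
     set (groups \<sigma>) = (\<lambda>k. (k, {x \<in> tracked st. cnt st x = k})) ` (cnt st ` tracked st)"

text \<open>
  The data structure has exactly the runs of the algorithm, never gets stuck and answers queries as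
  the algorithm does.
\<close>

definition sos_implements_fast :: "'a set \<Rightarrow> nat \<Rightarrow> nat \<Rightarrow> nat \<Rightarrow> bool" where
  "sos_implements_fast U M s n \<longleftrightarrow>
     (\<forall>p. weighted_stream U M p \<longrightarrow>
       (\<forall>st. fast_run s n p st \<longrightarrow> (\<exists>\<sigma>. sos_run s n p \<sigma> \<and> represents \<sigma> st)) \<and>
       (\<forall>\<sigma>. sos_run s n p \<sigma> \<longrightarrow> (\<exists>st. fast_run s n p st \<and> represents \<sigma> st)) \<and>
       (\<forall>\<sigma> st. sos_run s n p \<sigma> \<and> fast_run s n p st \<and> represents \<sigma> st \<longrightarrow>
         (\<forall>x\<in>U. \<exists>t. outcomes (sos_query s n \<sigma> x) = {(fast_query s n st x, t)})) \<and>
       (\<forall>\<sigma>. sos_run s n p \<sigma> \<longrightarrow>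
         (\<forall>x\<in>U. \<forall>w\<in>{1..M}. outcomes (sos_add s n x w \<sigma>) \<noteq> {})))"

definition sos_time_bound :: "nat \<Rightarrow> 'a set \<Rightarrow> nat \<Rightarrow> nat \<Rightarrow> nat \<Rightarrow> bool" where
  "sos_time_bound K U M s n \<longleftrightarrow>
     (\<forall>p \<sigma>. weighted_stream U M p \<and> sos_run s n p \<sigma> \<longrightarrow>
       (\<forall>x\<in>U. \<forall>w\<in>{1..M}. \<forall>(\<sigma>', t) \<in> outcomes (sos_add s n x w \<sigma>). t \<le> K) \<and>
       (\<forall>x\<in>U. \<forall>(v, t) \<in> outcomes (sos_query s n \<sigma> x). t \<le> K))"

end

theory Submission
  imports Defs
begin

text \<open>
  Accuracy: the estimate \<open>s * c + r\<close> of a tracked item never falls below its volume, because an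
  evicted item is dominated by \<open>s - 1\<close> plus \<open>s\<close> times the minimal counter, which never decreases.
  Conversely, every entry of the stream raises the sum of the tracked estimates by at most
  \<open>M + s - 1\<close>, so \<open>s\<close> times the minimal counter is at most \<open>N * M * (1 + \<phi>/2) / n\<close> for \<open>n\<close> counters.
  The rounding term \<open>s - 1 \<le> M * \<phi>/2\<close> is absorbed because a full table requires
  \<open>N \<ge> n \<ge> (1 + \<phi>) / \<epsilon>\<close>.

  Running time: a walk passes only groups whose \<open>c\<close>-values lie between the old (or minimal) value
  and the new one. These values are distinct, so there are at most
  \<open>(s - 1 + M) div s \<le> 1 + 2 / \<phi>\<close> of them.
\<close>

section \<open>Accuracy\<close>

lemma weighted_stream_snoc:
  "weighted_stream U M (p @ [(x, w)]) \<longleftrightarrow> weighted_stream U M p \<and> x \<in> U \<and> w \<in> {1..M}"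
  unfolding weighted_stream_def by auto

lemma volume_Nil: "volume [] x = 0"
  by (simp add: volume_def)

lemma volume_snoc: "volume (p @ [(y, w)]) x = volume p x + (if x = y then w else 0)"
proof -
  define I where "I = {i. i < length p \<and> fst (p ! i) = x}"
  have eq: "{i. i < length (p @ [(y, w)]) \<and> fst ((p @ [(y, w)]) ! i) = x} =
      (if x = y then insert (length p) I else I)"
    by (auto simp: I_def nth_append less_Suc_eq)
  have "(\<Sum>i\<in>I. snd ((p @ [(y, w)]) ! i)) = (\<Sum>i\<in>I. snd (p ! i))"
    by (rule sum.cong) (auto simp: I_def nth_append)
  moreover have "finite I" "length p \<notin> I"
    by (auto simp: I_def)
  ultimately show ?thesis
    unfolding volume_def eq by (simp add: I_def [symmetric])
qed

section \<open>Estimates and the state invariant of FAST\<close>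

definition fast_value :: "nat \<Rightarrow> 'a fast \<Rightarrow> 'a \<Rightarrow> nat" where
  "fast_value s st x = rmd st x + s * cnt st x"

text \<open>The last conjunct makes the insertion of a fresh item a special case of updating a
  tracked one: while a counter is free nothing has been evicted, so an untracked item has no
  leftover values. Once the table is full, evicted items keep stale values, hence the premise on the
  cardinality.\<close>

definition fast_wf :: "nat \<Rightarrow> nat \<Rightarrow> 'a fast \<Rightarrow> bool" where
  "fast_wf s n st \<longleftrightarrow> finite (tracked st) \<and> card (tracked st) \<le> n \<and> (\<forall>x. rmd st x < s) \<and>
     (card (tracked st) < n \<longrightarrow> (\<forall>x. x \<notin> tracked st \<longrightarrow> cnt st x = 0 \<and> rmd st x = 0))"

lemma fast_add_cases [consumes 1, case_names counted evict]:
  assumes "fast_add s n x w st st'"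
  obtains
    "x \<in> tracked st \<or> card (tracked st) < n"
    "st' = \<lparr>tracked = insert x (tracked st),
            cnt = (cnt st)(x := cnt st x + (rmd st x + w) div s),
            rmd = (rmd st)(x := (rmd st x + w) mod s)\<rparr>"
  | m where "x \<notin> tracked st" "n \<le> card (tracked st)" "m \<in> tracked st"
    "\<And>y. y \<in> tracked st \<Longrightarrow> cnt st m \<le> cnt st y"
    "st' = \<lparr>tracked = insert x (tracked st - {m}),
            cnt = (cnt st)(x := cnt st m + (s - 1 + w) div s),
            rmd = (rmd st)(x := (s - 1 + w) mod s)\<rparr>"
  using assms unfolding fast_add_def by (auto simp: is_arg_min_linorder split: if_splits)

lemma card_swap:
  assumes "finite A" "m \<in> A" "x \<notin> A"
  shows "card (insert x (A - {m})) = card A"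
  using assms by (simp add: card_Suc_Diff1 del: card_Diff_insert)

lemma fast_wf_init: "0 < s \<Longrightarrow> fast_wf s n fast_init"
  by (simp add: fast_wf_def fast_init_def)

lemma fast_wf_add:
  assumes "fast_add s n x w st st'" "fast_wf s n st" "0 < s"
  shows "fast_wf s n st'"
  using assms(1)
proof (cases rule: fast_add_cases)
  case counted
  then show ?thesis
    using assms(2,3) by (auto simp: fast_wf_def card_insert_if)
next
  case (evict m)
  then have "card (insert x (tracked st - {m})) = card (tracked st)"
    using assms(2) by (intro card_swap) (auto simp: fast_wf_def)
  then show ?thesis
    using evict assms(2,3) by (simp add: fast_wf_def)
qed

lemma fast_run_wf: "fast_run s n p st \<Longrightarrow> 0 < s \<Longrightarrow> fast_wf s n st"
  by (induction rule: fast_run.induct) (auto intro: fast_wf_init fast_wf_add)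

text \<open>Each entry starts tracking at most one new item. Applied to a full table this yields
  \<open>n \<le> length p\<close>, which pays for the rounding term \<open>s - 1\<close> of the
  error.\<close>

lemma card_tracked_le_length:
  assumes "fast_run s n p st" "0 < s"
  shows "card (tracked st) \<le> length p"
  using assms
proof (induction rule: fast_run.induct)
  case fast_run_Nil
  then show ?case by (simp add: fast_init_def)
next
  case (fast_run_snoc p st x w st')
  then have fin: "finite (tracked st)"
    using fast_run_wf fast_wf_def by blast
  from fast_run_snoc(2) show ?case
  proof (cases rule: fast_add_cases)
    case counted
    then show ?thesis using fast_run_snoc fin by (simp add: card_insert_if)
  next
    case (evict m)
    then show ?thesis using fast_run_snoc fin by (simp add: card_swap)
  qed
qed

section \<open>Growth of the total tracked estimate\<close>

lemma sum_fast_value_add: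
  assumes "fast_add s n x w st st'" "fast_wf s n st" "0 < s"
  shows "(\<Sum>y\<in>tracked st'. fast_value s st' y) \<le> (\<Sum>y\<in>tracked st. fast_value s st y) + (w + (s - 1))"
  using assms(1)
proof (cases rule: fast_add_cases)
  case counted
  have fin: "finite (tracked st)"
    using assms(2) by (simp add: fast_wf_def)
  have val: "fast_value s st' x = fast_value s st x + w"
    by (simp add: counted(2) fast_value_def algebra_simps)
  have rest: "(\<Sum>y\<in>tracked st - {x}. fast_value s st' y) = (\<Sum>y\<in>tracked st - {x}. fast_value s st y)"
    by (rule sum.cong) (auto simp: counted(2) fast_value_def)
  \<comment> \<open>A fresh item starts from estimate 0, so in this branch the total grows by
    exactly \<open>w\<close>, whether or not \<open>x\<close> was tracked.\<close>
  have new: "x \<notin> tracked st \<Longrightarrow> fast_value s st x = 0"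
    using counted(1) assms(2) by (auto simp: fast_wf_def fast_value_def)
  have "(\<Sum>y\<in>tracked st'. fast_value s st' y) =
      fast_value s st x + w + (\<Sum>y\<in>tracked st - {x}. fast_value s st y)"
    using fin by (simp add: counted(2) sum.insert_remove val[unfolded counted(2)] rest[unfolded counted(2)])
  also have "\<dots> = (\<Sum>y\<in>tracked st. fast_value s st y) + w"
    using fin new by (cases "x \<in> tracked st") (simp_all add: sum.remove)
  finally show ?thesis by simp
next
  case (evict m)
  have fin: "finite (tracked st)"
    using assms(2) by (simp add: fast_wf_def)
  have "fast_value s st' x = s * cnt st m + ((s - 1 + w) mod s + s * ((s - 1 + w) div s))"
    by (simp add: evict(5) fast_value_def algebra_simps)
  \<comment> \<open>The remainder of \<open>m\<close> is discarded and replaced by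
    \<open>s - 1\<close>. In the worst case that remainder was 0, so an eviction adds at most
    \<open>s - 1\<close> on top of \<open>w\<close>.\<close>
  then have val: "fast_value s st' x \<le> fast_value s st m + (w + (s - 1))"
    by (simp add: fast_value_def)
  have "(\<Sum>y\<in>tracked st'. fast_value s st' y) =
      fast_value s st' x + (\<Sum>y\<in>tracked st - {m}. fast_value s st' y)"
    using fin evict(1) by (simp add: evict(5))
  also have "(\<Sum>y\<in>tracked st - {m}. fast_value s st' y) = (\<Sum>y\<in>tracked st - {m}. fast_value s st y)"
    using evict(1) by (intro sum.cong) (auto simp: evict(5) fast_value_def)
  finally show ?thesis
    using val sum.remove[OF fin evict(3), of "fast_value s st"] by linarith
qed

lemma sum_fast_value_le:
  assumes "fast_run s n p st" "weighted_stream U M p" "0 < s"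
  shows "(\<Sum>y\<in>tracked st. fast_value s st y) \<le> length p * (M + (s - 1))"
  using assms
proof (induction rule: fast_run.induct)
  case fast_run_Nil
  then show ?case by (simp add: fast_init_def)
next
  case (fast_run_snoc p st x w st')
  then have "(\<Sum>y\<in>tracked st'. fast_value s st' y) \<le> (\<Sum>y\<in>tracked st. fast_value s st y) + (w + (s - 1))"
    by (intro sum_fast_value_add fast_run_wf)
  moreover have "w \<le> M" "weighted_stream U M p"
    using fast_run_snoc(4) by (auto simp: weighted_stream_snoc)
  moreover from this have "(\<Sum>y\<in>tracked st. fast_value s st y) \<le> length p * (M + (s - 1))"
    using fast_run_snoc(3,5) by blast
  ultimately show ?case by simp
qed

text \<open>An averaging argument: each of at least \<open>n\<close> tracked items contributes at
  least \<open>s * k\<close> to the total. Taking \<open>k\<close> to be any lower bound of the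
  counts covers both the count of an evicted item and the minimum used by a query.\<close>

lemma min_count_le:
  assumes "fast_run s n p st" "weighted_stream U M p" "0 < s"
    and "n \<le> card (tracked st)" "\<And>y. y \<in> tracked st \<Longrightarrow> k \<le> cnt st y"
  shows "n * (s * k) \<le> length p * (M + (s - 1))"
proof -
  have "n * (s * k) \<le> card (tracked st) * (s * k)"
    using assms(4) by (rule mult_le_mono1)
  also have "\<dots> \<le> (\<Sum>y\<in>tracked st. fast_value s st y)"
    using sum_bounded_below[of "tracked st" "s * k" "fast_value s st"] assms(5)
    by (simp add: fast_value_def trans_le_add2)
  also have "\<dots> \<le> length p * (M + (s - 1))"
    using assms sum_fast_value_le by blast
  finally show ?thesis .
qed

section \<open>Estimates are never too small\<close>

lemma volume_le_query:
  assumes "fast_run s n p st" "weighted_stream U M p" "0 < s" "0 < n"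
  shows "volume p x \<le> fast_query s n st x"
proof -
  \<comment> \<open>The induction needs a claim about untracked items too, since they may return.
    Bounding their volume against every tracked count, not against \<open>Min\<close>, gives the
    same information and is easier to maintain.\<close>
  have "(\<forall>x\<in>tracked st. volume p x \<le> fast_value s st x) \<and>
     (\<forall>x. x \<notin> tracked st \<longrightarrow> (if card (tracked st) < n then volume p x = 0
         else \<forall>y\<in>tracked st. volume p x \<le> s - 1 + s * cnt st y))"
    using assms(1,2)
  proof (induction rule: fast_run.induct)
    case fast_run_Nil
    then show ?case using assms(4) by (simp add: fast_init_def volume_Nil)
  next
    case (fast_run_snoc p st x w st')
    have wf: "fast_wf s n st"
      using fast_run_snoc assms(3) fast_run_wf by blast
    then have fin: "finite (tracked st)" and r: "\<And>y. rmd st y < s"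
      by (auto simp: fast_wf_def)
    have IH1: "volume p y \<le> fast_value s st y" if "y \<in> tracked st" for y
      using fast_run_snoc that by (simp add: weighted_stream_snoc)
    have IH2: "volume p y = 0" if "y \<notin> tracked st" "card (tracked st) < n" for y
      using fast_run_snoc that by (auto simp: weighted_stream_snoc)
    have IH3: "volume p y \<le> s - 1 + s * cnt st z"
      if "y \<notin> tracked st" "n \<le> card (tracked st)" "z \<in> tracked st" for y z
      using fast_run_snoc that by (auto simp: weighted_stream_snoc)
    from fast_run_snoc(2) show ?case
    proof (cases rule: fast_add_cases)
      case counted
      have val: "fast_value s st' x = fast_value s st x + w"
        by (simp add: counted(2) fast_value_def algebra_simps)
      have other: "fast_value s st' y = fast_value s st y" if "y \<noteq> x" for y
        using that by (simp add: counted(2) fast_value_def)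
      have tr: "tracked st' = insert x (tracked st)"
        by (simp add: counted(2))
      have vx: "volume p x \<le> fast_value s st x"
        using IH1 IH2 counted(1) by fastforce
      have mono: "cnt st y \<le> cnt st' y" for y
        by (simp add: counted(2))
      have bound: "volume p y \<le> s - 1 + s * cnt st' z"
        if "y \<notin> tracked st'" "n \<le> card (tracked st')" "z \<in> tracked st'" for y z
      \<comment> \<open>Either the table was already full, and counts have only grown, or
        \<open>x\<close> has just taken a free counter. In the latter case no untracked item has
        occurred yet, so its volume is 0.\<close>
      proof (cases "x \<in> tracked st \<or> n \<le> card (tracked st)")
        case True
        then have "z \<in> tracked st" "n \<le> card (tracked st)"
          using that counted(1) by (auto simp: tr insert_absorb)
        then have "volume p y \<le> s - 1 + s * cnt st z"
          using IH3 that(1) by (simp add: tr)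
        also have "\<dots> \<le> s - 1 + s * cnt st' z"
          using mono by simp
        finally show ?thesis .
      next
        case False
        then show ?thesis using IH2 that(1) by (simp add: tr)
      qed
      have zero: "volume p y = 0" if "y \<notin> tracked st'" "card (tracked st') < n" for y
        using IH2 that fin by (simp add: tr card_insert_if split: if_splits)
      show ?thesis
        using vx IH1 bound zero by (auto simp: volume_snoc val other tr)
    next
      case (evict m)
      have tr: "tracked st' = insert x (tracked st - {m})"
        by (simp add: evict(5))
      have "fast_value s st' x = s * cnt st m + ((s - 1 + w) mod s + s * ((s - 1 + w) div s))"
        by (simp add: evict(5) fast_value_def algebra_simps)
      \<comment> \<open>The new estimate is exactly the bound that held for the untracked
        \<open>x\<close>, plus \<open>w\<close>.\<close>
      then have val: "fast_value s st' x = s * cnt st m + (s - 1 + w)"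
        by simp
      have other: "fast_value s st' y = fast_value s st y" if "y \<noteq> x" for y
        using that by (simp add: evict(5) fast_value_def)
      have vx: "volume p x \<le> s - 1 + s * cnt st m"
        using IH3 evict by blast
      \<comment> \<open>The evicted item meets the bound for untracked items because its remainder
        is at most \<open>s - 1\<close>; this is why newcomers and queries use \<open>s - 1\<close>
        as the missing remainder.\<close>
      have vm: "volume p m \<le> s - 1 + s * cnt st m"
        using IH1[OF evict(3)] r[of m] by (simp add: fast_value_def)
      \<comment> \<open>The old minimum stays a lower bound: the other counts are unchanged, and
        that of \<open>x\<close> starts from \<open>cnt st m\<close>.\<close>
      have mono: "s * cnt st m \<le> s * cnt st' y" if "y \<in> tracked st'" for y
        using that evict(4) by (auto simp: evict(5))
      have bound: "volume p y \<le> s - 1 + s * cnt st' z"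
        if "y \<notin> tracked st'" "z \<in> tracked st'" for y z
      proof -
        have "volume p y \<le> s - 1 + s * cnt st m"
          using that(1) vm IH3[of y m] evict(2,3) by (cases "y = m") (auto simp: tr)
        with mono[OF that(2)] show ?thesis by linarith
      qed
      have "card (tracked st') = card (tracked st)"
        unfolding tr using fin evict(3,1) by (rule card_swap)
      then show ?thesis
        using vx IH1 bound evict(2) by (auto simp: volume_snoc val other tr)
    qed
  qed
  note inv = this
  have fin: "finite (tracked st)"
    using assms fast_run_wf fast_wf_def by blast
  show ?thesis
  proof (cases "x \<in> tracked st \<or> card (tracked st) < n")
    case True
    then show ?thesis
      using inv by (auto simp: fast_query_def fast_value_def split: if_splits)
  next
    case False
    then have "Min (cnt st ` tracked st) \<in> cnt st ` tracked st"
      using fin assms(4) by (intro Min_in) auto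
    then show ?thesis
      using False inv by (auto simp: fast_query_def)
  qed
qed

section \<open>Estimates are never too large\<close>

lemma min_estimate_le:
  fixes \<phi> \<epsilon> :: real
  assumes "fast_run s n p st" "weighted_stream U M p" "0 < s"
    and "n \<le> card (tracked st)" "\<And>y. y \<in> tracked st \<Longrightarrow> k \<le> cnt st y"
    and "0 < \<phi>" "0 < \<epsilon>" "real s - 1 \<le> real M * \<phi> / 2" "(1 + \<phi>) / \<epsilon> \<le> real n"
  shows "real (s - 1 + s * k) \<le> real (length p) * real M * \<epsilon>"
proof -
  define N where "N = real (length p)"
  have s1: "real (s - 1) = real s - 1"
    using assms(3) by simp
  have np: "1 + \<phi> \<le> real n * \<epsilon>"
    using assms(7,9) by (simp add: pos_divide_le_eq)
  have n0: "0 < real n"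
    using assms(6,7,9) less_le_trans[of 0 "(1 + \<phi>) / \<epsilon>" "real n"] by simp
  have Nn: "real n \<le> N"
    using card_tracked_le_length[OF assms(1,3)] assms(4) by (simp add: N_def)
  have "real (n * (s * k)) \<le> real (length p * (M + (s - 1)))"
    using min_count_le[OF assms(1-5)] of_nat_le_iff by blast
  then have "real n * (s * k) \<le> N * (M + (real s - 1))"
    unfolding of_nat_mult of_nat_add s1 N_def .
  also have "\<dots> \<le> N * (M + real M * \<phi> / 2)"
    using assms(8) by (intro mult_left_mono) (auto simp: N_def)
  finally have a: "real n * (s * k) \<le> N * M * (1 + \<phi> / 2)"
    by (simp add: algebra_simps)
  \<comment> \<open>The factor \<open>1 + \<phi>\<close> splits here: one half of \<phi> pays for
    the rounding accumulated in the counters, the other for the single \<open>s - 1\<close> in the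
    estimate, multiplied by \<open>n \<le> N\<close>.\<close>
  have "real n * (real s - 1) \<le> N * (real M * \<phi> / 2)"
    using Nn assms(3,8) by (intro mult_mono) (auto simp: N_def)
  with a have "real n * real (s - 1 + s * k) \<le> N * M * (1 + \<phi>)"
    unfolding of_nat_add s1 of_nat_mult by (simp add: algebra_simps)
  also have "\<dots> \<le> N * M * (real n * \<epsilon>)"
    using np by (intro mult_left_mono) (auto simp: N_def)
  finally have "real n * real (s - 1 + s * k) \<le> real n * (N * M * \<epsilon>)"
    by (simp add: algebra_simps)
  then show ?thesis
    using n0 unfolding N_def by (simp only: mult_le_cancel_left_pos)
qed

lemma query_le_volume:
  fixes \<phi> \<epsilon> :: real
  assumes "fast_run s n p st" "weighted_stream U M p" "0 < s" "0 < n"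
    and "0 < \<phi>" "0 < \<epsilon>" "real s - 1 \<le> real M * \<phi> / 2" "(1 + \<phi>) / \<epsilon> \<le> real n"
  shows "real (fast_query s n st x) \<le> real (volume p x) + real (length p) * real M * \<epsilon>"
proof -
  \<comment> \<open>Overestimation arises only when an item enters by eviction. From then on its
    estimate and its volume grow by the same weights until it is evicted.\<close>
  have inv: "\<forall>x\<in>tracked st. real (fast_value s st x) \<le> real (volume p x) + real (length p) * real M * \<epsilon>"
    using assms(1,2)
  proof (induction rule: fast_run.induct)
    case fast_run_Nil
    then show ?case by (simp add: fast_init_def)
  next
    case (fast_run_snoc p st x w st')
    have ws: "weighted_stream U M p"
      using fast_run_snoc(4) by (simp add: weighted_stream_snoc)
    have wf: "fast_wf s n st"
      using fast_run_snoc assms(3) fast_run_wf by blast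
    \<comment> \<open>The error allowed before the current entry. The allowance only grows with the
      stream, so it suffices to prove the step with the old value.\<close>
    define B where "B = real (length p) * real M * \<epsilon>"
    have B: "0 \<le> B" "B \<le> real (length (p @ [(x, w)])) * real M * \<epsilon>"
      using assms(6) by (auto simp: B_def algebra_simps)
    have IH: "real (fast_value s st y) \<le> real (volume p y) + B" if "y \<in> tracked st" for y
      using fast_run_snoc(3)[OF ws] that by (simp add: B_def)
    from fast_run_snoc(2)
    have "\<forall>y\<in>tracked st'. real (fast_value s st' y) \<le> real (volume (p @ [(x, w)]) y) + B"
    proof (cases rule: fast_add_cases)
      case counted
      have val: "fast_value s st' x = fast_value s st x + w"
        by (simp add: counted(2) fast_value_def algebra_simps)
      have other: "fast_value s st' y = fast_value s st y" if "y \<noteq> x" for y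
        using that by (simp add: counted(2) fast_value_def)
      have tr: "tracked st' = insert x (tracked st)"
        by (simp add: counted(2))
      have "x \<notin> tracked st \<Longrightarrow> fast_value s st x = 0"
        using wf counted(1) by (auto simp: fast_wf_def fast_value_def)
      then have "real (fast_value s st x) \<le> real (volume p x) + B"
        using IH B by (cases "x \<in> tracked st") auto
      then show ?thesis
        using IH by (auto simp: volume_snoc val other tr)
    next
      case (evict m)
      have tr: "tracked st' = insert x (tracked st - {m})"
        by (simp add: evict(5))
      have "fast_value s st' x = s * cnt st m + ((s - 1 + w) mod s + s * ((s - 1 + w) div s))"
        by (simp add: evict(5) fast_value_def algebra_simps)
      then have val: "fast_value s st' x = (s - 1 + s * cnt st m) + w"
        by simp
      have other: "fast_value s st' y = fast_value s st y" if "y \<noteq> x" for y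
        using that by (simp add: evict(5) fast_value_def)
      \<comment> \<open>The inherited value is entirely error in the worst case, since
        \<open>x\<close> may have had volume 0. The table was full before this entry, so the bound
        applies to \<open>p\<close> itself.\<close>
      have "real (s - 1 + s * cnt st m) \<le> B"
        unfolding B_def
        by (rule min_estimate_le[OF fast_run_snoc(1) ws assms(3) evict(2) _ assms(5-8)]) (rule evict(4))
      then have "real (fast_value s st' x) \<le> real (volume p x) + real w + B"
        unfolding val of_nat_add by simp
      then show ?thesis
        using IH other by (auto simp: volume_snoc tr)
    qed
    then show ?case
      using B(2) by force
  qed
  have wf: "fast_wf s n st"
    using assms fast_run_wf by blast
  have N0: "0 \<le> real (length p) * real M * \<epsilon>"
    using assms(6) by simp
  consider "x \<in> tracked st" | "x \<notin> tracked st" "card (tracked st) < n"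
    | "x \<notin> tracked st" "n \<le> card (tracked st)"
    by linarith
  then show ?thesis
  proof cases
    case 1
    then show ?thesis using inv by (simp add: fast_query_def fast_value_def)
  next
    case 2
    then show ?thesis using wf N0 by (simp add: fast_query_def fast_wf_def)
  next
    case 3
    have "real (s - 1 + s * Min (cnt st ` tracked st)) \<le> real (length p) * real M * \<epsilon>"
      by (rule min_estimate_le[OF assms(1-3) 3(2) _ assms(5-8)]) (use wf in \<open>simp add: fast_wf_def\<close>)
    then show ?thesis using 3 by (simp add: fast_query_def)
  qed
qed


section \<open>The ordered list of groups\<close>

lemma outcomes_ret [simp]: "outcomes (ret v) = {(v, 0)}"
  by (simp add: ret_def)

lemma outcomes_tick [simp]: "outcomes (tick v) = {(v, 1)}"
  by (simp add: tick_def)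

lemma outcomes_pick [simp]: "outcomes (pick A) = (\<lambda>v. (v, 1)) ` A"
  by (auto simp: pick_def)

lemma outcomes_bind [simp]:
  "outcomes (bind_comp m f) = (\<Union>(u, t)\<in>outcomes m. (\<lambda>(v, t'). (v, t + t')) ` outcomes (f u))"
  by (force simp: bind_comp_def)

text \<open>Each group passed costs a comparison and a move. The comparison that stops the walk
  costs one more, unless the list runs out first.\<close>

lemma outcomes_walk:
  "outcomes (walk k bef aft) =
    {((bef @ takeWhile (\<lambda>g. fst g < k) aft, dropWhile (\<lambda>g. fst g < k) aft),
      2 * length (takeWhile (\<lambda>g. fst g < k) aft) + (if \<forall>g\<in>set aft. fst g < k then 0 else 1))}"
  by (induction k bef aft rule: walk.induct) (auto simp: not_less)

text \<open>The keys of the groups passed are distinct integers in \<open>{lo..<k}\<close>. This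
  makes the cost of a walk independent of the number of counters.\<close>

lemma length_takeWhile_le:
  assumes "sorted_wrt (<) (map fst gs)" "\<And>g. g \<in> set gs \<Longrightarrow> lo \<le> fst g"
  shows "length (takeWhile (\<lambda>g. fst g < k) gs) \<le> (k - lo :: nat)"
proof -
  let ?T = "takeWhile (\<lambda>g. fst g < k) gs"
  have "distinct (map fst gs)"
    using assms(1) by (simp add: strict_sorted_iff)
  then have "distinct (map fst ?T)"
    by (metis map_append distinct_append takeWhile_dropWhile_id)
  moreover have "set (map fst ?T) \<subseteq> {lo..<k}"
    using assms(2) by (auto dest: set_takeWhileD)
  ultimately have "length (map fst ?T) \<le> card {lo..<k}"
    by (metis card_mono distinct_card finite_atLeastLessThan)
  then show ?thesis by simp
qed

text \<open>The list part of \<open>represents\<close>, freed from the state, so that it also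
  describes the intermediate list from which an item has been detached but not yet attached
  again.\<close>

definition grouping :: "('a \<Rightarrow> nat) \<Rightarrow> 'a set \<Rightarrow> 'a group list \<Rightarrow> bool" where
  "grouping c A gs \<longleftrightarrow> sorted_wrt (<) (map fst gs) \<and>
     set gs = (\<lambda>k. (k, {x \<in> A. c x = k})) ` (c ` A)"

lemma grouping_iff:
  "grouping c A gs \<longleftrightarrow> sorted_wrt (<) (map fst gs) \<and>
    (\<forall>k X. (k, X) \<in> set gs \<longleftrightarrow> X \<noteq> {} \<and> X = {x \<in> A. c x = k})"
proof -
  have "set gs = (\<lambda>k. (k, {x \<in> A. c x = k})) ` (c ` A) \<longleftrightarrow>
      (\<forall>k X. (k, X) \<in> set gs \<longleftrightarrow> (k, X) \<in> (\<lambda>k. (k, {x \<in> A. c x = k})) ` (c ` A))"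
    by auto
  also have "\<dots> \<longleftrightarrow> (\<forall>k X. (k, X) \<in> set gs \<longleftrightarrow> X \<noteq> {} \<and> X = {x \<in> A. c x = k})"
    by (intro arg_cong[where f = All] ext arg_cong2[where f = "(=)"] refl) (auto simp: image_iff)
  finally show ?thesis by (simp add: grouping_def)
qed

section \<open>Updates of an ordered group list\<close>

lemma grouping_detach:
  assumes "grouping c A (bef @ (k, X) # aft)" "x \<in> A" "c x = k"
  shows "grouping c (A - {x}) (bef @ detach x ((k, X) # aft))"
proof -
  have sorted: "sorted_wrt (<) (map fst (bef @ (k, X) # aft))"
    and mem: "\<And>j Y. (j, Y) \<in> set (bef @ (k, X) # aft) \<longleftrightarrow> Y \<noteq> {} \<and> Y = {x \<in> A. c x = j}"
    using assms(1) by (auto simp: grouping_iff)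
  have X: "X = {x \<in> A. c x = k}"
    using mem[of k X] by simp
  \<comment> \<open>Strictly increasing keys leave only one group with key \<open>k\<close>, so
    detaching cannot disturb the others, even when that group vanishes.\<close>
  have notin: "(k, Y) \<notin> set bef \<union> set aft" for Y
    using sorted by (auto simp: sorted_wrt_append)
  have rest: "(j, Y) \<in> set bef \<union> set aft \<longleftrightarrow> j \<noteq> k \<and> Y \<noteq> {} \<and> Y = {x \<in> A. c x = j}" for j Y
    using notin[of Y] mem[of j Y] by auto
  have sub: "{y \<in> A - {x}. c y = j} = (if j = k then X - {x} else {y \<in> A. c y = j})" for j
    using X assms(3) by auto
  have "(j, Y) \<in> set (bef @ detach x ((k, X) # aft)) \<longleftrightarrow>
      Y \<noteq> {} \<and> Y = {y \<in> A - {x}. c y = j}" for j Y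
    using rest[of j Y] unfolding sub by (auto split: if_splits)
  moreover have "sorted_wrt (<) (map fst (bef @ detach x ((k, X) # aft)))"
    using sorted by (auto simp: sorted_wrt_append)
  ultimately show ?thesis
    by (simp only: grouping_iff) blast
qed

text \<open>The bounds on \<open>bef\<close> and \<open>aft\<close> are what a finished walk
  guarantees: a group with key \<open>k\<close> either heads \<open>aft\<close> or does not exist.
  As \<open>x\<close> lies outside \<open>A\<close>, changing its count moves no other item.\<close>

lemma grouping_attach:
  assumes "grouping c A (bef @ aft)" "x \<notin> A"
    and "\<And>g. g \<in> set bef \<Longrightarrow> fst g < k" "\<And>g. g \<in> set aft \<Longrightarrow> k \<le> fst g"
  shows "grouping (c(x := k)) (insert x A) (bef @ attach x k aft)"
proof -
  have sorted: "sorted_wrt (<) (map fst (bef @ aft))"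
    and mem: "\<And>j Y. (j, Y) \<in> set (bef @ aft) \<longleftrightarrow> Y \<noteq> {} \<and> Y = {x \<in> A. c x = j}"
    using assms(1) by (auto simp: grouping_iff)
  have sub: "{y \<in> insert x A. (c(x := k)) y = j} =
      (if j = k then insert x {y \<in> A. c y = k} else {y \<in> A. c y = j})" for j
    using assms(2) by auto
  have "sorted_wrt (<) (map fst (bef @ attach x k aft)) \<and>
    (\<forall>j Y. (j, Y) \<in> set (bef @ attach x k aft) \<longleftrightarrow> Y \<noteq> {} \<and>
       Y = (if j = k then insert x {y \<in> A. c y = k} else {y \<in> A. c y = j}))"
  proof (cases "\<exists>X aft'. aft = (k, X) # aft'")
    case True
    then obtain X aft' where aft: "aft = (k, X) # aft'" by blast
    have X: "X = {y \<in> A. c y = k}"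
      using mem[of k X] by (simp add: aft)
    have notin: "(k, Y) \<notin> set bef \<union> set aft'" for Y
      using sorted by (auto simp: sorted_wrt_append aft)
    have rest: "(j, Y) \<in> set bef \<union> set aft' \<longleftrightarrow> j \<noteq> k \<and> Y \<noteq> {} \<and> Y = {x \<in> A. c x = j}" for j Y
      using notin[of Y] mem[of j Y] by (auto simp: aft)
    have "sorted_wrt (<) (map fst (bef @ attach x k aft))"
      using sorted by (auto simp: sorted_wrt_append aft)
    moreover have "(j, Y) \<in> set (bef @ attach x k aft) \<longleftrightarrow> Y \<noteq> {} \<and>
       Y = (if j = k then insert x {y \<in> A. c y = k} else {y \<in> A. c y = j})" for j Y
      using rest[of j Y] X by (auto simp: aft)
    ultimately show ?thesis by blast
  next
    case False
    then have att: "attach x k aft = (k, {x}) # aft"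
      by (cases "(x, k, aft)" rule: attach.cases) auto
    have less: "k < fst g" if "g \<in> set aft" for g
    proof (cases aft)
      case (Cons h t)
      then have "k < fst h"
        using False assms(4)[of h] by (cases h) auto
      with Cons that sorted show ?thesis
        by (auto simp: sorted_wrt_append)
    qed (use that in simp)
    have notin: "(k, Y) \<notin> set bef \<union> set aft" for Y
      using assms(3) less by force
    \<comment> \<open>If some item had count \<open>k\<close>, its group would be in the list. Hence
      the singleton \<open>{x}\<close> is the whole new group.\<close>
    then have none: "{y \<in> A. c y = k} = {}"
      using mem[of k "{y \<in> A. c y = k}"] by auto
    have rest: "(j, Y) \<in> set bef \<union> set aft \<longleftrightarrow> j \<noteq> k \<and> Y \<noteq> {} \<and> Y = {x \<in> A. c x = j}" for j Y
      using notin[of Y] mem[of j Y] by auto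
    have "sorted_wrt (<) (map fst (bef @ attach x k aft))"
      using sorted less assms(3) by (auto simp: sorted_wrt_append att)
    moreover have "(j, Y) \<in> set (bef @ attach x k aft) \<longleftrightarrow> Y \<noteq> {} \<and>
       Y = (if j = k then insert x {y \<in> A. c y = k} else {y \<in> A. c y = j})" for j Y
      using rest[of j Y] none by (auto simp: att)
    ultimately show ?thesis by blast
  qed
  then show ?thesis
    unfolding grouping_iff sub .
qed

text \<open>No invariant on the list is assumed, so results can be chosen uniformly, even for items
  that are not candidates for eviction.\<close>

lemma place_deterministic: "\<exists>gs t. outcomes (place x k bef aft) = {(gs, t)}"
  by (simp add: place_def outcomes_walk)

text \<open>Of the two extra cost units, one covers the comparison that ends the walk and one the
  attachment.\<close>

lemma place_outcomes:
  assumes "grouping c A (bef @ aft)" "x \<notin> A"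
    and "\<And>g. g \<in> set bef \<Longrightarrow> fst g < k" "\<And>g. g \<in> set aft \<Longrightarrow> lo \<le> fst g"
  obtains gs t where "outcomes (place x k bef aft) = {(gs, t)}"
    "grouping (c(x := k)) (insert x A) gs" "t \<le> 2 * (k - lo) + 2"
proof -
  let ?T = "takeWhile (\<lambda>g. fst g < k) aft" and ?D = "dropWhile (\<lambda>g. fst g < k) aft"
  have sorted: "sorted_wrt (<) (map fst aft)"
    using assms(1) by (simp add: grouping_def sorted_wrt_append)
  have D: "k \<le> fst g" if "g \<in> set ?D" for g
  proof (cases ?D)
    case Nil
    show ?thesis using that unfolding Nil by simp
  next
    case (Cons h D')
    then have "\<not> fst h < k"
      by (metis hd_dropWhile list.discI list.sel(1))
    moreover have "sorted_wrt (<) (map fst ?D)"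
      using sorted
      by (metis map_append sorted_wrt_append takeWhile_dropWhile_id)
    ultimately show ?thesis
      using that Cons by auto
  qed
  have "grouping c A ((bef @ ?T) @ ?D)"
    using assms(1) by simp
  then have "grouping (c(x := k)) (insert x A) ((bef @ ?T) @ attach x k ?D)"
    using assms(2,3) D by (intro grouping_attach) (auto dest: set_takeWhileD)
  then have "grouping (c(x := k)) (insert x A) (bef @ ?T @ attach x k ?D)"
    by simp
  moreover define t where "t = 2 * length ?T + (if \<forall>g\<in>set aft. fst g < k then 0 else 1) + 1"
  have "outcomes (place x k bef aft) = {(bef @ ?T @ attach x k ?D, t)}"
    by (simp add: place_def outcomes_walk t_def)
  moreover have "t \<le> 2 * (k - lo) + 2"
    using length_takeWhile_le[OF sorted assms(4), of k] by (simp add: t_def)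
  ultimately show ?thesis
    using that by blast
qed

text \<open>Sortedness puts all smaller keys before the located group, so a walk towards a larger
  count may start there instead of at the front.\<close>

lemma grouping_locate:
  assumes "grouping c A gs" "x \<in> A"
  obtains bef X aft where "locate (c x) gs = (bef, (c x, X) # aft)" "gs = bef @ (c x, X) # aft"
    "\<And>g. g \<in> set bef \<Longrightarrow> fst g < c x" "\<And>g. g \<in> set aft \<Longrightarrow> c x \<le> fst g"
proof -
  let ?P = "\<lambda>g. fst g \<noteq> c x"
  have "(c x, {y \<in> A. c y = c x}) \<in> set gs"
    using assms by (auto simp: grouping_def)
  then have ne: "dropWhile ?P gs \<noteq> []"
    by (force simp: dropWhile_eq_Nil_conv)
  then obtain h aft where ha: "dropWhile ?P gs = h # aft"
    by (cases "dropWhile ?P gs") auto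
  moreover have "fst h = c x"
    using hd_dropWhile[OF ne] by (simp add: ha)
  ultimately obtain X where eq: "dropWhile ?P gs = (c x, X) # aft"
    by (cases h) auto
  have gs: "gs = takeWhile ?P gs @ (c x, X) # aft"
    by (metis eq takeWhile_dropWhile_id)
  have "sorted_wrt (<) (map fst (takeWhile ?P gs @ (c x, X) # aft))"
    using assms(1) gs by (simp add: grouping_def)
  then show ?thesis
    by (intro that[OF _ gs]) (auto simp: locate_def eq sorted_wrt_append intro: less_imp_le)
qed

text \<open>The first group is the full set of minimisers. Picking any of its items therefore
  realises exactly the arbitrary choice of FAST, and its key answers a query for the
  minimum.\<close>

lemma grouping_hd:
  assumes "grouping c A gs" "A \<noteq> {}"
  obtains k gs' where "gs = (k, {m. is_arg_min c (\<lambda>y. y \<in> A) m}) # gs'" "k \<in> c ` A"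
    "\<And>y. y \<in> A \<Longrightarrow> k \<le> c y" "\<And>g. g \<in> set gs' \<Longrightarrow> k \<le> fst g"
proof -
  have "gs \<noteq> []"
    using assms by (auto simp: grouping_def)
  then obtain k X gs' where gs: "gs = (k, X) # gs'"
    by (metis list.exhaust surj_pair)
  have "(k, X) \<in> set gs"
    by (simp add: gs)
  then have X: "X = {y \<in> A. c y = k}" and k: "k \<in> c ` A"
    using assms(1) by (auto simp: grouping_def)
  have tl: "k \<le> fst g" if "g \<in> set gs'" for g
    using assms(1) that by (auto simp: grouping_def gs)
  have min: "k \<le> c y" if "y \<in> A" for y
  proof -
    have "(c y, {z \<in> A. c z = c y}) \<in> set gs"
      using assms(1) that by (auto simp: grouping_def)
    then show ?thesis using tl by (force simp: gs)
  qed
  have "X = {m. is_arg_min c (\<lambda>y. y \<in> A) m}"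
    using k min by (auto simp: X is_arg_min_linorder intro: antisym)
  then show ?thesis
    using that[of k gs'] gs k min tl by simp
qed


section \<open>Simulation\<close>

lemma represents_iff:
  "represents \<sigma> st \<longleftrightarrow> finite (tracked st) \<and> used \<sigma> = card (tracked st) \<and>
     htable \<sigma> = (\<lambda>x. if x \<in> tracked st then Some (cnt st x, rmd st x) else None) \<and>
     grouping (cnt st) (tracked st) (groups \<sigma>)"
  by (simp add: represents_def grouping_def)

lemma sos_add_counted:
  assumes "represents \<sigma> st" "fast_wf s n st" "0 < s"
    and "x \<in> tracked st \<or> card (tracked st) < n"
  obtains \<sigma>' t where "outcomes (sos_add s n x w \<sigma>) = {(\<sigma>', t)}"
    "t \<le> 2 * ((s - 1 + w) div s) + 12"
    "represents \<sigma>' \<lparr>tracked = insert x (tracked st),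
            cnt = (cnt st)(x := cnt st x + (rmd st x + w) div s),
            rmd = (rmd st)(x := (rmd st x + w) mod s)\<rparr>"
proof -
  have rep: "finite (tracked st)" "used \<sigma> = card (tracked st)"
     "htable \<sigma> = (\<lambda>x. if x \<in> tracked st then Some (cnt st x, rmd st x) else None)"
     "grouping (cnt st) (tracked st) (groups \<sigma>)"
    using assms(1) by (auto simp: represents_iff)
  have "rmd st x < s"
    using assms(2) by (simp add: fast_wf_def)
  \<comment> \<open>A remainder is at most \<open>s - 1\<close>, so updates without eviction obey
    the same quotient bound as evictions.\<close>
  then have q: "(rmd st x + w) div s \<le> (s - 1 + w) div s"
    by (intro div_le_mono) simp
  show ?thesis
  proof (cases "x \<in> tracked st")
    case True
    obtain bef X aft where loc: "locate (cnt st x) (groups \<sigma>) = (bef, (cnt st x, X) # aft)"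
      and gs: "groups \<sigma> = bef @ (cnt st x, X) # aft"
      and bef: "\<And>g. g \<in> set bef \<Longrightarrow> fst g < cnt st x"
      and aft: "\<And>g. g \<in> set aft \<Longrightarrow> cnt st x \<le> fst g"
      using grouping_locate[OF rep(4) True] by blast
    have det: "grouping (cnt st) (tracked st - {x}) (bef @ detach x ((cnt st x, X) # aft))"
      using rep(4) True by (intro grouping_detach) (simp_all add: gs)
    let ?k = "cnt st x + (rmd st x + w) div s"
    obtain gs' t where pl: "outcomes (place x ?k bef (detach x ((cnt st x, X) # aft))) = {(gs', t)}"
      "grouping ((cnt st)(x := ?k)) (insert x (tracked st - {x})) gs'"
      "t \<le> 2 * (?k - cnt st x) + 2"
      by (rule place_outcomes[OF det, of x ?k "cnt st x"])
        (use bef aft in \<open>auto intro: trans_less_add1 split: if_splits\<close>)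
    have out: "outcomes (sos_add s n x w \<sigma>) =
      {(\<lparr>groups = gs', htable = (htable \<sigma>)(x := Some (?k, (rmd st x + w) mod s)), used = used \<sigma>\<rparr>,
        9 + t)}"
      using True by (simp add: sos_add_def rep(3) loc pl(1) del: detach.simps)
    show ?thesis
      by (rule that[OF out]) (use pl q True in \<open>auto simp: represents_iff rep insert_absorb\<close>)
  next
    case False
    then have free: "card (tracked st) < n" and zero: "cnt st x = 0" "rmd st x = 0"
      using assms(2,4) by (auto simp: fast_wf_def)
    \<comment> \<open>Here the walk starts at the front, but the target key is only
      \<open>w div s\<close>, so the lower bound 0 on the keys suffices.\<close>
    obtain gs' t where pl: "outcomes (place x (w div s) [] (groups \<sigma>)) = {(gs', t)}"
      "grouping ((cnt st)(x := w div s)) (insert x (tracked st)) gs'"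
      "t \<le> 2 * (w div s - 0) + 2"
      by (rule place_outcomes[of "cnt st" "tracked st" "[]" "groups \<sigma>" x "w div s" 0])
        (use rep(4) False in auto)
    have out: "outcomes (sos_add s n x w \<sigma>) =
      {(\<lparr>groups = gs', htable = (htable \<sigma>)(x := Some (w div s, w mod s)), used = used \<sigma> + 1\<rparr>,
        6 + t)}"
      using False free by (simp add: sos_add_def rep(2,3) pl(1))
    show ?thesis
      by (rule that[OF out]) (use pl q False zero in \<open>auto simp: represents_iff rep\<close>)
  qed
qed

lemma sos_add_evict:
  assumes "represents \<sigma> st" "0 < n"
    and "x \<notin> tracked st" "n \<le> card (tracked st)"
  obtains f T where
    "outcomes (sos_add s n x w \<sigma>) = (\<lambda>m. (f m, T m)) ` {m. is_arg_min (cnt st) (\<lambda>y. y \<in> tracked st) m}"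
    "\<And>m. is_arg_min (cnt st) (\<lambda>y. y \<in> tracked st) m \<Longrightarrow> T m \<le> 2 * ((s - 1 + w) div s) + 14 \<and>
       represents (f m) \<lparr>tracked = insert x (tracked st - {m}),
                 cnt = (cnt st)(x := cnt st m + (s - 1 + w) div s),
                 rmd = (rmd st)(x := (s - 1 + w) mod s)\<rparr>"
proof -
  have rep: "finite (tracked st)" "used \<sigma> = card (tracked st)"
     "htable \<sigma> = (\<lambda>x. if x \<in> tracked st then Some (cnt st x, rmd st x) else None)"
     "grouping (cnt st) (tracked st) (groups \<sigma>)"
    using assms(1) by (auto simp: represents_iff)
  define A where "A = {m. is_arg_min (cnt st) (\<lambda>y. y \<in> tracked st) m}"
  have "tracked st \<noteq> {}"
    using assms(2,4) by auto
  then obtain k gs where gs: "groups \<sigma> = (k, A) # gs" and k: "k \<in> cnt st ` tracked st"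
    and min: "\<And>y. y \<in> tracked st \<Longrightarrow> k \<le> cnt st y" and tl: "\<And>g. g \<in> set gs \<Longrightarrow> k \<le> fst g"
    using grouping_hd[OF rep(4)] unfolding A_def by blast
  let ?k = "k + (s - 1 + w) div s"
  have A_iff: "m \<in> tracked st" "cnt st m = k" if "m \<in> A" for m
    using that k min by (auto simp: A_def is_arg_min_linorder intro!: antisym)
  \<comment> \<open>Determinism is claimed for every \<open>m\<close> and the invariant only for
    minimisers. Results and costs can thus be turned into total functions of
    \<open>m\<close>.\<close>
  have "\<exists>g t. outcomes (place x ?k [] (detach m ((k, A) # gs))) = {(g, t)} \<and> (m \<in> A \<longrightarrow>
      grouping ((cnt st)(x := ?k)) (insert x (tracked st - {m})) g \<and> t \<le> 2 * (?k - k) + 2)" for m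
  proof (cases "m \<in> A")
    case True
    have "grouping (cnt st) (tracked st - {m}) ([] @ detach m ((k, A) # gs))"
      using rep(4) A_iff[OF True] by (intro grouping_detach) (simp_all add: gs)
    then show ?thesis
      by (rule place_outcomes[of _ _ _ _ x ?k k]) (use assms(3) tl in \<open>auto split: if_splits\<close>)
  qed (use place_deterministic in metis)
  then obtain g t where pl: "\<And>m. outcomes (place x ?k [] (detach m ((k, A) # gs))) = {(g m, t m)}"
    "\<And>m. m \<in> A \<Longrightarrow> grouping ((cnt st)(x := ?k)) (insert x (tracked st - {m})) (g m)"
    "\<And>m. m \<in> A \<Longrightarrow> t m \<le> 2 * (?k - k) + 2"
    by metis
  define f where "f m = \<lparr>groups = g m,
    htable = (htable \<sigma>)(m := None, x := Some (?k, (s - 1 + w) mod s)), used = used \<sigma>\<rparr>" for m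
  \<comment> \<open>Besides the placement an eviction performs twelve unit-cost operations. With the
    two extra units of the placement this gives the constant 14.\<close>
  have out: "outcomes (sos_add s n x w \<sigma>) = (\<lambda>m. (f m, 12 + t m)) ` A"
    using assms(3,4)
    by (simp add: sos_add_def rep(2,3) gs pl(1)[unfolded One_nat_def] f_def image_UN
        image_image UNION_singleton_eq_range numeral_eq_Suc del: detach.simps)
  have "represents (f m) \<lparr>tracked = insert x (tracked st - {m}),
                 cnt = (cnt st)(x := cnt st m + (s - 1 + w) div s),
                 rmd = (rmd st)(x := (s - 1 + w) mod s)\<rparr>" if "m \<in> A" for m
  proof -
    have "card (insert x (tracked st - {m})) = card (tracked st)"
      using rep(1) A_iff(1)[OF that] assms(3) by (rule card_swap)
    \<comment> \<open>FAST keeps stale values for \<open>m\<close>, but they are hidden from the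
      table because \<open>m\<close> is no longer tracked.\<close>
    moreover have "(htable \<sigma>)(m := None, x := Some (?k, (s - 1 + w) mod s)) =
        (\<lambda>y. if y \<in> insert x (tracked st - {m})
          then Some (((cnt st)(x := ?k)) y, ((rmd st)(x := (s - 1 + w) mod s)) y) else None)"
      by (rule ext) (simp add: rep(3))
    ultimately show ?thesis
      using pl(2)[OF that] A_iff(2)[OF that] rep(1,2) by (simp add: represents_iff f_def del: One_nat_def cong: if_cong)
  qed
  moreover have "12 + t m \<le> 2 * ((s - 1 + w) div s) + 14" if "m \<in> A" for m
    using pl(3)[OF that] by simp
  ultimately show ?thesis
    using that[of f "\<lambda>m. 12 + t m"] out by (simp add: A_def)
qed

text \<open>Soundness and completeness match the choices in both directions: without eviction both
  sides have a single result, and with eviction both choose from the same nonempty set of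
  minimisers.\<close>

lemma sos_add_simulation:
  assumes "represents \<sigma> st" "fast_wf s n st" "0 < s" "0 < n"
  shows sos_add_sound: "(\<sigma>', t) \<in> outcomes (sos_add s n x w \<sigma>) \<Longrightarrow>
      t \<le> 2 * ((s - 1 + w) div s) + 14 \<and> (\<exists>st'. fast_add s n x w st st' \<and> represents \<sigma>' st')"
    and sos_add_complete: "fast_add s n x w st st' \<Longrightarrow>
      \<exists>\<sigma>' t. (\<sigma>', t) \<in> outcomes (sos_add s n x w \<sigma>) \<and> represents \<sigma>' st'"
    and sos_add_progress: "outcomes (sos_add s n x w \<sigma>) \<noteq> {}"
proof -
  have "((\<sigma>', t) \<in> outcomes (sos_add s n x w \<sigma>) \<longrightarrow>
      t \<le> 2 * ((s - 1 + w) div s) + 14 \<and> (\<exists>st'. fast_add s n x w st st' \<and> represents \<sigma>' st')) \<and>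
     (fast_add s n x w st st' \<longrightarrow>
      (\<exists>\<sigma>' t. (\<sigma>', t) \<in> outcomes (sos_add s n x w \<sigma>) \<and> represents \<sigma>' st')) \<and>
     outcomes (sos_add s n x w \<sigma>) \<noteq> {}"
  proof (cases "x \<in> tracked st \<or> card (tracked st) < n")
    case True
    have "fast_add s n x w st st'' \<longleftrightarrow>
        st'' = \<lparr>tracked = insert x (tracked st),
              cnt = (cnt st)(x := cnt st x + (rmd st x + w) div s),
              rmd = (rmd st)(x := (rmd st x + w) mod s)\<rparr>" for st''
      using True by (simp only: fast_add_def if_True)
    moreover obtain \<sigma>'' t'' where "outcomes (sos_add s n x w \<sigma>) = {(\<sigma>'', t'')}"
      "t'' \<le> 2 * ((s - 1 + w) div s) + 12"
      "represents \<sigma>'' \<lparr>tracked = insert x (tracked st),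
              cnt = (cnt st)(x := cnt st x + (rmd st x + w) div s),
              rmd = (rmd st)(x := (rmd st x + w) mod s)\<rparr>"
      by (rule sos_add_counted[OF assms(1-3) True, of w])
    ultimately show ?thesis
      by simp
  next
    case False
    have "finite (tracked st)" "tracked st \<noteq> {}"
      using False assms(2,4) by (auto simp: fast_wf_def)
    then obtain m where "is_arg_min (cnt st) (\<lambda>y. y \<in> tracked st) m"
      by (metis ex_is_arg_min_if_finite)
    then have "{m. is_arg_min (cnt st) (\<lambda>y. y \<in> tracked st) m} \<noteq> {}"
      by blast
    moreover obtain f T where
      "outcomes (sos_add s n x w \<sigma>) = (\<lambda>m. (f m, T m)) ` {m. is_arg_min (cnt st) (\<lambda>y. y \<in> tracked st) m}"
      "\<And>m. is_arg_min (cnt st) (\<lambda>y. y \<in> tracked st) m \<Longrightarrow> T m \<le> 2 * ((s - 1 + w) div s) + 14 \<and>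
         represents (f m) \<lparr>tracked = insert x (tracked st - {m}),
                   cnt = (cnt st)(x := cnt st m + (s - 1 + w) div s),
                   rmd = (rmd st)(x := (s - 1 + w) mod s)\<rparr>"
      by (rule sos_add_evict[OF assms(1,4), of x s w]) (use False in auto)
    ultimately show ?thesis
      using False by (auto simp: fast_add_def)
  qed
  then show "(\<sigma>', t) \<in> outcomes (sos_add s n x w \<sigma>) \<Longrightarrow>
      t \<le> 2 * ((s - 1 + w) div s) + 14 \<and> (\<exists>st'. fast_add s n x w st st' \<and> represents \<sigma>' st')"
    and "fast_add s n x w st st' \<Longrightarrow>
      \<exists>\<sigma>' t. (\<sigma>', t) \<in> outcomes (sos_add s n x w \<sigma>) \<and> represents \<sigma>' st'"
    and "outcomes (sos_add s n x w \<sigma>) \<noteq> {}"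
    by blast+
qed

lemma sos_query_outcomes:
  assumes "represents \<sigma> st" "fast_wf s n st" "0 < n"
  obtains t where "outcomes (sos_query s n \<sigma> x) = {(fast_query s n st x, t)}" "t \<le> 6"
proof -
  have rep: "finite (tracked st)" "used \<sigma> = card (tracked st)"
     "htable \<sigma> = (\<lambda>x. if x \<in> tracked st then Some (cnt st x, rmd st x) else None)"
     "grouping (cnt st) (tracked st) (groups \<sigma>)"
    using assms(1) by (auto simp: represents_iff)
  consider "x \<in> tracked st" | "x \<notin> tracked st" "card (tracked st) < n"
    | "x \<notin> tracked st" "n \<le> card (tracked st)"
    by linarith
  then show ?thesis
  proof cases
    case 1
    then obtain bef X aft where "locate (cnt st x) (groups \<sigma>) = (bef, (cnt st x, X) # aft)"
      using grouping_locate[OF rep(4)] by metis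
    then show ?thesis
      using 1 by (intro that[of 5]) (simp_all add: sos_query_def rep(3) fast_query_def)
  next
    case 2
    then show ?thesis
      using assms(2)
      \<comment> \<open>The program answers 0 without looking up any value; \<open>fast_wf\<close>
        ensures that FAST computes 0 as well.\<close>
      by (intro that[of 2]) (simp_all add: sos_query_def rep(2,3) fast_query_def fast_wf_def)
  next
    case 3
    then have "tracked st \<noteq> {}"
      using assms(3) by auto
    then obtain k X gs where gs: "groups \<sigma> = (k, X) # gs" and "k \<in> cnt st ` tracked st"
      "\<And>y. y \<in> tracked st \<Longrightarrow> k \<le> cnt st y"
      using grouping_hd[OF rep(4)] by metis
    then have "Min (cnt st ` tracked st) = k"
      using rep(1) by (intro Min_eqI) auto
    then show ?thesis
      using 3 by (intro that[of 6]) (simp_all add: sos_query_def rep(2,3) fast_query_def gs)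
  qed
qed

section \<open>Whole runs and the resulting guarantees\<close>

lemma sos_run_complete:
  assumes "fast_run s n p st" "0 < s" "0 < n"
  shows "\<exists>\<sigma>. sos_run s n p \<sigma> \<and> represents \<sigma> st"
  using assms(1)
proof (induction rule: fast_run.induct)
  case fast_run_Nil
  have "represents sos_init fast_init"
    by (simp add: represents_def sos_init_def fast_init_def)
  then show ?case using sos_run.sos_run_Nil by blast
next
  case (fast_run_snoc p st x w st')
  then obtain \<sigma> where \<sigma>: "sos_run s n p \<sigma>" "represents \<sigma> st" by blast
  with fast_run_snoc(2) obtain \<sigma>' t where
    "(\<sigma>', t) \<in> outcomes (sos_add s n x w \<sigma>)" "represents \<sigma>' st'"
    using sos_add_complete[OF \<sigma>(2) fast_run_wf[OF fast_run_snoc(1) assms(2)] assms(2,3)] by blast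
  with \<sigma>(1) show ?case
    using sos_run.sos_run_snoc by metis
qed

lemma sos_run_sound:
  assumes "sos_run s n p \<sigma>" "0 < s" "0 < n"
  shows "\<exists>st. fast_run s n p st \<and> represents \<sigma> st"
  using assms(1)
proof (induction rule: sos_run.induct)
  case sos_run_Nil
  have "represents sos_init fast_init"
    by (simp add: represents_def sos_init_def fast_init_def)
  then show ?case using fast_run.fast_run_Nil by blast
next
  case (sos_run_snoc p \<sigma> \<sigma>' t x w)
  then obtain st where st: "fast_run s n p st" "represents \<sigma> st" by blast
  with sos_run_snoc(2) obtain st' where "fast_add s n x w st st'" "represents \<sigma>' st'"
    using sos_add_sound[OF st(2) fast_run_wf[OF st(1) assms(2)] assms(2,3)] by blast
  with st(1) show ?case
    using fast_run.fast_run_snoc by metis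
qed

lemma sos_implements_fast:
  assumes "0 < s" "0 < n"
  shows "sos_implements_fast U M s n"
  unfolding sos_implements_fast_def
proof (intro allI impI conjI ballI)
  fix p and st :: "'a fast" assume "fast_run s n p st"
  then show "\<exists>\<sigma>. sos_run s n p \<sigma> \<and> represents \<sigma> st"
    using assms sos_run_complete by blast
next
  fix p and \<sigma> :: "'a sos" assume "sos_run s n p \<sigma>"
  then show "\<exists>st. fast_run s n p st \<and> represents \<sigma> st"
    using assms sos_run_sound by blast
next
  fix p x and \<sigma> :: "'a sos" and st
  assume "sos_run s n p \<sigma> \<and> fast_run s n p st \<and> represents \<sigma> st"
  then show "\<exists>t. outcomes (sos_query s n \<sigma> x) = {(fast_query s n st x, t)}"
    using assms fast_run_wf sos_query_outcomes by metis
next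
  fix p x w and \<sigma> :: "'a sos" assume "sos_run s n p \<sigma>"
  then show "outcomes (sos_add s n x w \<sigma>) \<noteq> {}"
    using assms sos_run_sound fast_run_wf sos_add_progress by metis
qed

text \<open>The cost of an Add is monotone in the weight, so \<open>w = M\<close> is the worst case.
  A query costs at most 6, which the constant 14 covers.\<close>

lemma sos_time_bound:
  assumes "0 < s" "0 < n" "2 * ((s - 1 + M) div s) + 14 \<le> K"
  shows "sos_time_bound K U M s n"
  unfolding sos_time_bound_def
proof (intro allI impI)
  fix p and \<sigma> :: "'a sos" assume "weighted_stream U M p \<and> sos_run s n p \<sigma>"
  then obtain st where st: "fast_run s n p st" "represents \<sigma> st"
    using sos_run_sound[OF _ assms(1,2)] by blast
  note wf = fast_run_wf[OF st(1) assms(1)]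
  have "t \<le> K" if "(\<sigma>', t) \<in> outcomes (sos_add s n x w \<sigma>)" "w \<le> M" for x w \<sigma>' t
  proof -
    have "(s - 1 + w) div s \<le> (s - 1 + M) div s"
      using that(2) by (intro div_le_mono) simp
    with sos_add_sound[OF st(2) wf assms(1,2) that(1)] assms(3) show ?thesis by linarith
  qed
  moreover have "t \<le> K" if "(v, t) \<in> outcomes (sos_query s n \<sigma> x)" for x v t
  proof -
    obtain t' where "outcomes (sos_query s n \<sigma> x) = {(fast_query s n st x, t')}" "t' \<le> 6"
      using sos_query_outcomes[OF st(2) wf assms(2)] by blast
    with that assms(3) show ?thesis by simp
  qed
  ultimately show "(\<forall>x\<in>U. \<forall>w\<in>{1..M}. \<forall>(\<sigma>', t)\<in>outcomes (sos_add s n x w \<sigma>). t \<le> K) \<and>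
      (\<forall>x\<in>U. \<forall>(v, t)\<in>outcomes (sos_query s n \<sigma> x). t \<le> K)"
    by auto
qed

theorem theorem2:
  fixes \<phi> :: real
  assumes "\<phi> > 0"
  shows "\<exists>K. \<forall>(\<epsilon>::real) (M::nat) (U::'a set). \<epsilon> > 0 \<and> M > 0 \<longrightarrow>
    sos_implements_fast U M (fast_unit M \<phi>) (fast_counters \<epsilon> \<phi>) \<and>
    sos_time_bound K U M (fast_unit M \<phi>) (fast_counters \<epsilon> \<phi>) \<and>
    solves_volume_estimation U M \<epsilon>
      (fast_run (fast_unit M \<phi>) (fast_counters \<epsilon> \<phi>))
      (fast_query (fast_unit M \<phi>) (fast_counters \<epsilon> \<phi>))"
proof (rule exI[of _ "2 * nat \<lceil>1 + 2 / \<phi>\<rceil> + 14"], intro allI impI)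
  fix \<epsilon> :: real and M :: nat and U :: "'a set"
  assume "\<epsilon> > 0 \<and> M > 0"
  then have pos: "0 < \<epsilon>" "0 < M" by auto
  define s where "s = fast_unit M \<phi>"
  define n where "n = fast_counters \<epsilon> \<phi>"
  have M\<phi>: "0 < real M * \<phi>"
    using assms pos by simp
  have s: "real s = of_int \<lfloor>real M * \<phi> / 2 + 1\<rfloor>"
    using M\<phi> by (simp add: s_def fast_unit_def)
  \<comment> \<open>The two sides of the floor serve different goals: the upper bound on
    \<open>s\<close> limits the rounding error, the strict lower bound limits the quotients and
    hence the walks.\<close>
  have s_le: "real s - 1 \<le> real M * \<phi> / 2" and less_s: "real M * \<phi> / 2 < real s"
    unfolding s by linarith+
  have s0: "0 < s"
    using less_s M\<phi> by (cases s) auto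
  have n_ge: "(1 + \<phi>) / \<epsilon> \<le> real n"
    unfolding n_def fast_counters_def by (rule real_nat_ceiling_ge)
  moreover have "0 < (1 + \<phi>) / \<epsilon>"
    using assms pos by simp
  ultimately have n0: "0 < n"
    by (cases n) auto
  \<comment> \<open>Since \<open>s\<close> exceeds \<open>M * \<phi> / 2\<close>, the quotient is at
    most \<open>1 + 2 / \<phi>\<close>, whatever \<open>M\<close> and \<epsilon> are. The witness
    for \<open>K\<close> is this bound inserted into the cost of an Add.\<close>
  have "real ((s - 1 + M) div s) \<le> real (s - 1 + M) / real s"
    by (rule of_nat_div_le_of_nat)
  also have "\<dots> \<le> (real s + M) / real s"
    using s0 by (intro divide_right_mono) auto
  also have "\<dots> = 1 + M / real s"
    using s0 by (simp add: field_simps)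
  also have "real M / real s \<le> 2 / \<phi>"
    using less_s s0 assms by (simp add: field_simps)
  finally have "(s - 1 + M) div s \<le> nat \<lceil>1 + 2 / \<phi>\<rceil>"
    by linarith
  then have "sos_time_bound (2 * nat \<lceil>1 + 2 / \<phi>\<rceil> + 14) U M s n"
    using s0 n0 by (intro sos_time_bound) auto
  moreover have "solves_volume_estimation U M \<epsilon> (fast_run s n) (fast_query s n)"
    unfolding solves_volume_estimation_def
    using volume_le_query[OF _ _ s0 n0] query_le_volume[OF _ _ s0 n0 assms pos(1) s_le n_ge]
    by (metis of_nat_le_iff)
  ultimately show "sos_implements_fast U M (fast_unit M \<phi>) (fast_counters \<epsilon> \<phi>) \<and>
    sos_time_bound (2 * nat \<lceil>1 + 2 / \<phi>\<rceil> + 14) U M (fast_unit M \<phi>) (fast_counters \<epsilon> \<phi>) \<and>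
    solves_volume_estimation U M \<epsilon>
      (fast_run (fast_unit M \<phi>) (fast_counters \<epsilon> \<phi>))
      (fast_query (fast_unit M \<phi>) (fast_counters \<epsilon> \<phi>))"
    using sos_implements_fast[OF s0 n0] by (simp add: s_def n_def)
qed

end
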